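(* Let $\Gamma$ be a Fuchsian group of the first kind, let $k$ be a nonzero real number, let $\nu$ be a multiplier system of weight $k$ for $\Gamma$, and let $f\in M_u(\Gamma,k,\nu)$ be an unrestricted automorphic form of weight $k$ and multiplier system $\nu$ which is holomorphic on $\mathbb{H}$. Let $x\in\mathbb{R}\cup\{\infty\}$ be a fixed point of a parabolic element $\gamma$ of $\Gamma$, and suppose that $f$ is meromorphic at the cusp $x$, with Fourier expansion at $x$ $$(f|_k\sigma)(z)=e^{2\pi i\kappa z/n}\sum_{m=N}^{\infty}a_m e^{2\pi i m z/n},\qquad z\in\mathbb{H},\ N\in\mathbb{Z}.$$ If $a_m=0$ for all sufficiently large $m$, then $f=0$.
   Context: $\mathbb{H}$ is the upper half-plane; $\mathrm{PSL}_2(\mathbb{R})=\mathrm{SL}_2(\mathbb{R})/\{\pm I\}$ acts on $\mathbb{H}\cup\mathbb{R}\cup\{\infty\}$ by Möbius transformations. A Fuchsian group is a discrete subgroup $\Gamma$ of $\mathrm{PSL}_2(\mathbb{R})$; its limit set is the set of all limit points of orbits $\Gamma z$, $z\in\mathbb{H}$; it is of the first kind if its limit set is $\mathbb{R}\cup\{\infty\}$. Let $\widetilde\Gamma\subset\mathrm{SL}_2(\mathbb{R})$ be the preimage of $\Gamma$. Real powers are taken with the principal branch of the logarithm. For $\sigma=\begin{pmatrix}a&b\\c&d\end{pmatrix}\in\mathrm{SL}_2(\mathbb{R})$, $(f|_k\sigma)(z)=(cz+d)^{-k}f(\sigma z)$. A multiplier system of weight $k\in\mathbb{R}$ for $\Gamma$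 is a function $\nu:\widetilde\Gamma\to\{w\in\mathbb{C}:|w|=1\}$ such that $\mu_\gamma(z)=\nu(\gamma)(cz+d)^k$, for $\gamma=\begin{pmatrix}a&b\\c&d\end{pmatrix}\in\widetilde\Gamma$ and $z\in\mathbb{H}$, satisfies $\mu_{\alpha\gamma}(z)=\mu_\alpha(\gamma z)\mu_\gamma(z)$ and $\mu_{-\gamma}(z)=\mu_\gamma(z)$ for all $\alpha,\gamma\in\widetilde\Gamma$, $z\in\mathbb{H}$. $M_u(\Gamma,k,\nu)$ is the space of meromorphic functions $f$ on $\mathbb{H}$ with $f|_k\gamma=\nu(\gamma)f$ for all $\gamma\in\widetilde\Gamma$. Fourier expansion at a cusp: let $x$ be fixed by a parabolic $\gamma\in\Gamma$. Put $\sigma=\begin{pmatrix}-x&1\\-1&0\end{pmatrix}$ if $x\in\mathbb{R}$ and $\sigma=I$ if $x=\infty$, so $\sigma\infty=x$. Replacing $\gamma$ by $\gamma^{-1}$ if necessary, $\sigma^{-1}\gamma\sigma$ is the translation $z\mapsto z+n$ with $n>0$, and there is $\kappa\in[0,1)$, determined by $\nu$ and $\gamma$, such that $(f|_k\sigma)(z+n)=e^{2\pi i\kappa}(f|_k\sigma)(z)$. Thus $e^{-2\pi i\kappa z/n}(f|_k\sigma)(z)$ is $n$-periodic and, $f$ being holomorphic on $\mathbb{H}$, is a Laurent series in $e^{2\pi i z/n}$; $f$ is meromorphic at the cusp $x$ if this series has only finitely many terms with negative index, i.e. starts at some $N\in\mathbb{Z}$. *)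

theory Defs
  imports "HOL-Complex_Analysis.Complex_Analysis" "HOL-Algebra.Coset"
begin

abbreviation upper_half_plane :: "complex set" where
  "upper_half_plane \<equiv> {z. Im z > 0}"

definition mat2 :: "real \<Rightarrow> real \<Rightarrow> real \<Rightarrow> real \<Rightarrow> real^2^2" where
  "mat2 a b c d = vector [vector [a, b], vector [c, d]]"

lemma mat2_nth [simp]:
  "mat2 a b c d $ 1 $ 1 = a" "mat2 a b c d $ 1 $ 2 = b"
  "mat2 a b c d $ 2 $ 1 = c" "mat2 a b c d $ 2 $ 2 = d"
  by (simp_all add: mat2_def)

definition SL2R :: "(real^2^2) monoid" where
  "SL2R = \<lparr>carrier = {A. det A = 1}, mult = (**), one = mat 1\<rparr>"

definition PSL2R :: "(real^2^2) set monoid" where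
  "PSL2R = SL2R Mod {mat 1, - mat 1}"

definition proj_PSL :: "real^2^2 \<Rightarrow> (real^2^2) set" where
  "proj_PSL A = {mat 1, - mat 1} #>\<^bsub>SL2R\<^esub> A"

lemma group_SL2R: "group SL2R"
proof (rule groupI)
  fix A assume "A \<in> carrier SL2R"
  then have A: "det A = 1" by (simp add: SL2R_def)
  then have "invertible A" by (simp add: invertible_det_nz)
  then obtain B where B: "B ** A = mat 1" by (auto simp: invertible_def)
  then have "det B * det A = 1" by (metis det_I det_mul)
  with A B show "\<exists>B\<in>carrier SL2R. B \<otimes>\<^bsub>SL2R\<^esub> A = \<one>\<^bsub>SL2R\<^esub>"
    by (auto simp: SL2R_def)
qed (auto simp: SL2R_def det_mul det_I matrix_mul_assoc)

lemma mem_carrier_SL2R [simp]: "A \<in> carrier SL2R \<longleftrightarrow> det A = 1"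
  and mult_SL2R [simp]: "A \<otimes>\<^bsub>SL2R\<^esub> B = A ** B"
  and one_SL2R [simp]: "\<one>\<^bsub>SL2R\<^esub> = mat 1"
  by (simp_all add: SL2R_def)

lemma matrix_mul_minus_left [simp]: "- A ** B = - (A ** B)"
  and matrix_mul_minus_right [simp]: "A ** - B = - (A ** B)"
  for A B :: "real^2^2"
  by (simp_all add: matrix_matrix_mult_def vec_eq_iff sum_negf)

lemma det_minus_2 [simp]: "det (- A) = det A" for A :: "real^2^2"
  by (simp add: det_2)

lemma proj_PSL_eq: "proj_PSL A = {A, - A}"
  by (auto simp: proj_PSL_def r_coset_def)

lemma normal_center_SL2R: "{mat 1, - mat 1} \<lhd> SL2R"
proof -
  interpret group SL2R by (rule group_SL2R)
  have inv: "inv\<^bsub>SL2R\<^esub> (- mat 1) = - mat 1"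
    by (rule inv_equality) auto
  have "subgroup {mat 1, - mat 1} SL2R"
    using inv inv_one by unfold_locales auto
  moreover have "{mat 1, - mat 1} #>\<^bsub>SL2R\<^esub> A = A <#\<^bsub>SL2R\<^esub> {mat 1, - mat 1}" for A
    by (auto simp: r_coset_def l_coset_def)
  ultimately show ?thesis by (intro normalI) auto
qed

lemma group_PSL2R: "group PSL2R"
  unfolding PSL2R_def by (rule normal.factorgroup_is_group[OF normal_center_SL2R])

lemma carrier_PSL2R: "carrier PSL2R = proj_PSL ` {A. det A = 1}"
  by (auto simp: PSL2R_def carrier_FactGroup proj_PSL_def)

text \<open>The quotient topology induced by the projection from \<open>SL\<^sub>2(\<real>)\<close>, which carries
  the subspace topology of the space of real matrices.\<close>

definition PSL2R_topology :: "(real^2^2) set topology" where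
  "PSL2R_topology = topology (\<lambda>U. U \<subseteq> carrier PSL2R \<and>
     openin (top_of_set (carrier SL2R)) {A \<in> carrier SL2R. proj_PSL A \<in> U})"

lemma openin_PSL2R_topology:
  "openin PSL2R_topology U \<longleftrightarrow> U \<subseteq> carrier PSL2R \<and>
     openin (top_of_set (carrier SL2R)) {A \<in> carrier SL2R. proj_PSL A \<in> U}"
proof -
  have 1: "{A \<in> carrier SL2R. proj_PSL A \<in> S \<inter> T} =
      {A \<in> carrier SL2R. proj_PSL A \<in> S} \<inter> {A \<in> carrier SL2R. proj_PSL A \<in> T}" for S T
    by auto
  have 2: "{A \<in> carrier SL2R. proj_PSL A \<in> \<Union>K} =
      (\<Union>S\<in>K. {A \<in> carrier SL2R. proj_PSL A \<in> S})" for K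
    by auto
  have "istopology (\<lambda>U. U \<subseteq> carrier PSL2R \<and>
     openin (top_of_set (carrier SL2R)) {A \<in> carrier SL2R. proj_PSL A \<in> U})"
    unfolding istopology_def 1 2 by (intro conjI allI impI) (auto intro!: openin_Union)
  then show ?thesis by (simp add: PSL2R_topology_def topology_inverse')
qed

text \<open>The Riemann sphere is the one-point compactification of the complex plane, with
  \<^term>\<open>None\<close> as the point at infinity.\<close>

abbreviation riemann_sphere :: "complex option topology" where
  "riemann_sphere \<equiv> Alexandroff_compactification euclidean"

definition extended_real_line :: "complex option set" where
  "extended_real_line = insert None (range (\<lambda>t::real. Some (of_real t)))"

definition auto_factor :: "real^2^2 \<Rightarrow> complex \<Rightarrow> complex" where
  "auto_factor A z = of_real (A $ 2 $ 1) * z + of_real (A $ 2 $ 2)"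

definition moebius_mat :: "real^2^2 \<Rightarrow> complex \<Rightarrow> complex" where
  "moebius_mat A = moebius (of_real (A $ 1 $ 1)) (of_real (A $ 1 $ 2))
                           (of_real (A $ 2 $ 1)) (of_real (A $ 2 $ 2))"

definition moebius_ext :: "real^2^2 \<Rightarrow> complex option \<Rightarrow> complex option" where
  "moebius_ext A p = (case p of
      None \<Rightarrow> if A $ 2 $ 1 = 0 then None else Some (of_real (A $ 1 $ 1 / A $ 2 $ 1))
    | Some z \<Rightarrow> if auto_factor A z = 0 then None else Some (moebius_mat A z))"

text \<open>The common value of the action of the two representatives of an element of
  \<open>PSL\<^sub>2(\<real>)\<close>.\<close>

definition PSL_act :: "(real^2^2) set \<Rightarrow> complex option \<Rightarrow> complex option" where
  "PSL_act g p = the_elem ((\<lambda>A. moebius_ext A p) ` g)"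

lemma moebius_ext_minus: "moebius_ext (- A) p = moebius_ext A p"
proof -
  have 1: "auto_factor (- A) z = - auto_factor A z" for z
    by (simp add: auto_factor_def)
  have "moebius_mat B z = (of_real (B $ 1 $ 1) * z + of_real (B $ 1 $ 2)) / auto_factor B z"
    for B z
    by (simp add: moebius_mat_def moebius_def auto_factor_def)
  then have "moebius_mat (- A) z = moebius_mat A z" for z
    using minus_divide_divide[of "of_real (A $ 1 $ 1) * z + of_real (A $ 1 $ 2)" "auto_factor A z"]
    by (simp add: 1)
  with 1 show ?thesis
    by (simp add: moebius_ext_def split: option.split)
qed

lemma PSL_act_proj [simp]: "PSL_act (proj_PSL A) p = moebius_ext A p"
  by (simp add: PSL_act_def proj_PSL_eq moebius_ext_minus)

definition fuchsian_group :: "(real^2^2) set set \<Rightarrow> bool" where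
  "fuchsian_group \<Gamma> \<longleftrightarrow> subgroup \<Gamma> PSL2R \<and> subtopology PSL2R_topology \<Gamma> = discrete_topology \<Gamma>"

definition limit_set :: "(real^2^2) set set \<Rightarrow> complex option set" where
  "limit_set \<Gamma> = (\<Union>z\<in>upper_half_plane.
     riemann_sphere derived_set_of ((\<lambda>g. PSL_act g (Some z)) ` \<Gamma>))"

definition first_kind :: "(real^2^2) set set \<Rightarrow> bool" where
  "first_kind \<Gamma> \<longleftrightarrow> limit_set \<Gamma> = extended_real_line"

definition parabolic :: "(real^2^2) set \<Rightarrow> bool" where
  "parabolic g \<longleftrightarrow> g \<in> carrier PSL2R \<and> g \<noteq> \<one>\<^bsub>PSL2R\<^esub> \<and> (\<forall>A\<in>g. \<bar>trace A\<bar> = 2)"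

definition SL_lift :: "(real^2^2) set set \<Rightarrow> (real^2^2) set" where
  "SL_lift \<Gamma> = {A \<in> carrier SL2R. proj_PSL A \<in> \<Gamma>}"

text \<open>The function \<open>powr\<close> on complex numbers is defined by the principal branch of the
  logarithm, with imaginary part in \<open>(-\<pi>, \<pi>]\<close>.\<close>

definition slash :: "real \<Rightarrow> (complex \<Rightarrow> complex) \<Rightarrow> real^2^2 \<Rightarrow> complex \<Rightarrow> complex" where
  "slash k f A z = auto_factor A z powr of_real (- k) * f (moebius_mat A z)"

definition mult_factor ::
    "real \<Rightarrow> (real^2^2 \<Rightarrow> complex) \<Rightarrow> real^2^2 \<Rightarrow> complex \<Rightarrow> complex" where
  "mult_factor k \<nu> A z = \<nu> A * auto_factor A z powr of_real k"

definition multiplier_system ::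
    "(real^2^2) set set \<Rightarrow> real \<Rightarrow> (real^2^2 \<Rightarrow> complex) \<Rightarrow> bool" where
  "multiplier_system \<Gamma> k \<nu> \<longleftrightarrow>
     (\<forall>A\<in>SL_lift \<Gamma>. cmod (\<nu> A) = 1) \<and>
     (\<forall>A\<in>SL_lift \<Gamma>. \<forall>B\<in>SL_lift \<Gamma>. \<forall>z\<in>upper_half_plane.
        mult_factor k \<nu> (A ** B) z = mult_factor k \<nu> A (moebius_mat B z) * mult_factor k \<nu> B z) \<and>
     (\<forall>A\<in>SL_lift \<Gamma>. \<forall>z\<in>upper_half_plane. mult_factor k \<nu> (- A) z = mult_factor k \<nu> A z)"

text \<open>Values of a meromorphic function at its poles carry no information in HOL, so the
  transformation law, an identity of meromorphic functions, is required outside a discrete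
  closed subset of the upper half-plane.\<close>

definition M_u ::
    "(real^2^2) set set \<Rightarrow> real \<Rightarrow> (real^2^2 \<Rightarrow> complex) \<Rightarrow> (complex \<Rightarrow> complex) set" where
  "M_u \<Gamma> k \<nu> = {f. f meromorphic_on upper_half_plane \<and>
     (\<forall>A\<in>SL_lift \<Gamma>. \<forall>\<^sub>\<approx>z\<in>upper_half_plane. slash k f A z = \<nu> A * f z)}"

definition cusp_matrix :: "complex option \<Rightarrow> real^2^2" where
  "cusp_matrix x = (case x of None \<Rightarrow> mat 1 | Some t \<Rightarrow> mat2 (- Re t) 1 (- 1) 0)"

lemma moebius_ext_cusp_matrix:
  "x \<in> extended_real_line \<Longrightarrow> moebius_ext (cusp_matrix x) None = x"
  by (auto simp: extended_real_line_def moebius_ext_def cusp_matrix_def mat_def)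

lemma det_cusp_matrix: "det (cusp_matrix x) = 1"
  by (auto simp: cusp_matrix_def det_2 mat_def split: option.split)

text \<open>The element \<open>g\<close> is conjugated by \<open>\<sigma>\<close> to the translation by \<open>n\<close>, where \<open>\<sigma>\<close> is the
  matrix sending infinity to the cusp \<open>x\<close>.\<close>

definition conj_to_translation :: "(real^2^2) set \<Rightarrow> complex option \<Rightarrow> real \<Rightarrow> bool" where
  "conj_to_translation g x n \<longleftrightarrow> (let s = proj_PSL (cusp_matrix x) in
     \<forall>z\<in>upper_half_plane.
       PSL_act (inv\<^bsub>PSL2R\<^esub> s \<otimes>\<^bsub>PSL2R\<^esub> g \<otimes>\<^bsub>PSL2R\<^esub> s) (Some z) = Some (z + of_real n))"

text \<open>The parameter \<open>N\<close> being an integer, this says in particular that \<open>f\<close> is meromorphic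
  at the cusp \<open>x\<close>.\<close>

definition has_cusp_expansion ::
    "(complex \<Rightarrow> complex) \<Rightarrow> real \<Rightarrow> complex option \<Rightarrow> real \<Rightarrow> real \<Rightarrow> int \<Rightarrow> (int \<Rightarrow> complex) \<Rightarrow> bool" where
  "has_cusp_expansion f k x n \<kappa> N a \<longleftrightarrow> (\<forall>z\<in>upper_half_plane.
     (\<lambda>m. a m * exp (2 * of_real pi * \<i> * of_int m * z / of_real n)) summable_on {N..} \<and>
     slash k f (cusp_matrix x) z = exp (2 * of_real pi * \<i> * of_real \<kappa> * z / of_real n) *
       (\<Sum>\<^sub>\<infinity>m\<in>{N..}. a m * exp (2 * of_real pi * \<i> * of_int m * z / of_real n)))"

end

theory Submission
  imports Defs
begin

text \<open>A finite Fourier expansion makes \<open>G = f|\<^sub>k\<sigma>\<close> the restriction of an entire exponential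
  polynomial whose absolute value is bounded and \<open>n\<close>-periodic on \<open>\<real>\<close>. By continuity
  \<open>\<bar>G(Bs)\<bar> = \<bar>cs + d\<bar>\<^sup>k \<bar>G(s)\<bar>\<close> for real \<open>s\<close> and every \<open>B = (a b; c d)\<close> in \<open>\<sigma>\<^sup>-\<^sup>1\<Gamma>\<sigma>\<close>; fix one with
  \<open>c \<noteq> 0\<close>. Taking \<open>s = y + jn\<close> and letting \<open>j \<rightarrow> \<infinity>\<close>, boundedness forces \<open>G(y) = 0\<close> for all real \<open>y\<close>
  if \<open>k > 0\<close>. If \<open>k < 0\<close> it forces \<open>G(a/c) = 0\<close>, hence \<open>G\<close> vanishes at the points \<open>B(a/c + jn)\<close>, which
  accumulate at \<open>a/c\<close>. In both cases \<open>G = 0\<close>.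

  If no such \<open>B\<close> existed, the conjugated group would consist of affine maps. Either one of them is
  not a translation, and conjugating \<open>z \<mapsto> z + n\<close> by its powers gives arbitrarily small translations,
  hence limit points in the upper half-plane; or all are translations, and \<open>\<sigma>\<infinity>\<close> is the only
  possible real limit point. Both contradict the first kind.\<close>

unbundle no Formal_Power_Series.fps_syntax

section \<open>Real 2 by 2 matrices and their Moebius action\<close>

lemma matrix_mult_2_nth:
  fixes A B :: "real^2^2"
  shows "(A ** B) $ i $ j = A $ i $ 1 * B $ 1 $ j + A $ i $ 2 * B $ 2 $ j"
  by (simp add: matrix_matrix_mult_def sum_2)

text \<open>The adjugate serves as the inverse on SL_2. Its entries are polynomial in those of the
  matrix, so identities reduce to entrywise algebra.\<close>

definition adj2 :: "real^2^2 \<Rightarrow> real^2^2" where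
  "adj2 A = mat2 (A $ 2 $ 2) (- A $ 1 $ 2) (- A $ 2 $ 1) (A $ 1 $ 1)"

lemma adj2_mult: "det A = 1 \<Longrightarrow> adj2 A ** A = mat 1"
  and mult_adj2: "det A = 1 \<Longrightarrow> A ** adj2 A = mat 1"
  and det_adj2: "det (adj2 A) = det A"
  by (simp_all add: vec_eq_iff forall_2 matrix_mult_2_nth adj2_def mat_def det_2 algebra_simps)

lemma moebius_mat_eq:
  "moebius_mat A z = (of_real (A $ 1 $ 1) * z + of_real (A $ 1 $ 2)) / auto_factor A z"
  by (simp add: moebius_mat_def moebius_def auto_factor_def)

lemma auto_factor_nonzero:
  assumes "det A = 1" "Im z > 0"
  shows "auto_factor A z \<noteq> 0"
proof
  assume "auto_factor A z = 0"
  then have "A $ 2 $ 1 * Re z + A $ 2 $ 2 = 0" "A $ 2 $ 1 * Im z = 0"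
    by (auto simp: auto_factor_def complex_eq_iff)
  then show False using assms by (auto simp: det_2)
qed

lemma Im_moebius_mat_pos:
  assumes "det A = 1" "Im z > 0"
  shows "Im (moebius_mat A z) > 0"
proof -
  have "Im ((of_real (A $ 1 $ 1) * z + of_real (A $ 1 $ 2)) * cnj (auto_factor A z)) = det A * Im z"
    by (simp add: auto_factor_def det_2 algebra_simps)
  then show ?thesis
    using assms by (simp add: moebius_mat_eq Im_complex_div_gt_0)
qed

lemma auto_factor_mult:
  assumes "auto_factor B z \<noteq> 0"
  shows "auto_factor (A ** B) z = auto_factor A (moebius_mat B z) * auto_factor B z"
  using assms by (simp add: moebius_mat_eq auto_factor_def matrix_mult_2_nth field_simps)

lemma moebius_mat_mult:
  assumes "auto_factor B z \<noteq> 0"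
  shows "moebius_mat (A ** B) z = moebius_mat A (moebius_mat B z)"
proof -
  have "of_real ((A ** B) $ 1 $ 1) * z + of_real ((A ** B) $ 1 $ 2) =
      (of_real (A $ 1 $ 1) * moebius_mat B z + of_real (A $ 1 $ 2)) * auto_factor B z"
    using assms by (simp add: moebius_mat_eq matrix_mult_2_nth field_simps)
      (simp add: auto_factor_def algebra_simps)
  then show ?thesis
    using assms by (simp add: moebius_mat_eq[of "A ** B"] moebius_mat_eq[of A] auto_factor_mult)
qed

lemma moebius_mat_one [simp]: "moebius_mat (mat 1) z = z"
  by (simp add: moebius_mat_eq auto_factor_def mat_def)

lemma moebius_mat_adj2:
  assumes "det A = 1" "Im z > 0"
  shows "moebius_mat A (moebius_mat (adj2 A) z) = z" "moebius_mat (adj2 A) (moebius_mat A z) = z"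
  using assms moebius_mat_mult[of "adj2 A" z A] moebius_mat_mult[of A z "adj2 A"]
  by (auto simp: mult_adj2 adj2_mult det_adj2 auto_factor_nonzero)

lemma continuous_on_auto_factor [continuous_intros]:
  "continuous_on S h \<Longrightarrow> continuous_on S (\<lambda>z. auto_factor A (h z))"
  unfolding auto_factor_def by (intro continuous_intros)

lemma isCont_moebius_mat:
  "auto_factor A z \<noteq> 0 \<Longrightarrow> isCont (moebius_mat A) z"
  unfolding moebius_mat_eq[abs_def] auto_factor_def by (intro continuous_intros) auto

lemma continuous_on_moebius_mat:
  "det A = 1 \<Longrightarrow> continuous_on upper_half_plane (moebius_mat A)"
  by (intro continuous_at_imp_continuous_on) (auto simp: auto_factor_nonzero intro!: isCont_moebius_mat)

section \<open>Passing from PSL_2 to matrix representatives\<close>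

lemma proj_PSL_mult:
  assumes "det A = 1" "det B = 1"
  shows "proj_PSL A \<otimes>\<^bsub>PSL2R\<^esub> proj_PSL B = proj_PSL (A ** B)"
  using normal.rcos_sum[OF normal_center_SL2R, of A B] assms
  by (simp add: PSL2R_def proj_PSL_def FactGroup_def)

lemma proj_PSL_one: "proj_PSL (mat 1) = \<one>\<^bsub>PSL2R\<^esub>"
  by (auto simp: PSL2R_def proj_PSL_eq)

lemma inv_proj_PSL:
  assumes "det A = 1"
  shows "inv\<^bsub>PSL2R\<^esub> (proj_PSL A) = proj_PSL (adj2 A)"
  using assms
  by (intro group.inv_equality[OF group_PSL2R])
     (auto simp: proj_PSL_mult det_adj2 adj2_mult proj_PSL_one carrier_PSL2R)

lemma SL_liftD: "A \<in> SL_lift \<Gamma> \<Longrightarrow> det A = 1"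
  by (simp add: SL_lift_def)

lemma mult_mem_SL_lift:
  assumes "subgroup \<Gamma> PSL2R" "A \<in> SL_lift \<Gamma>" "B \<in> SL_lift \<Gamma>"
  shows "A ** B \<in> SL_lift \<Gamma>"
  using assms subgroup.m_closed[OF assms(1), of "proj_PSL A" "proj_PSL B"]
  by (simp add: SL_lift_def det_mul proj_PSL_mult)

lemma adj2_mem_SL_lift:
  assumes "subgroup \<Gamma> PSL2R" "A \<in> SL_lift \<Gamma>"
  shows "adj2 A \<in> SL_lift \<Gamma>"
  using assms subgroup.m_inv_closed[OF assms(1), of "proj_PSL A"]
  by (simp add: SL_lift_def det_adj2 inv_proj_PSL)

lemma proj_PSL_SL_lift:
  assumes "subgroup \<Gamma> PSL2R"
  shows "\<Gamma> = proj_PSL ` SL_lift \<Gamma>"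
  using subgroup.subset[OF assms] by (auto simp: SL_lift_def carrier_PSL2R)

section \<open>Finite limit points of orbits\<close>

lemma derived_set_of_riemann_sphere:
  "Some z \<in> riemann_sphere derived_set_of (Some ` S) \<longleftrightarrow> z islimpt S"
proof
  assume L: "Some z \<in> riemann_sphere derived_set_of (Some ` S)"
  show "z islimpt S"
    unfolding islimpt_def
  proof (intro allI impI)
    fix T assume T: "z \<in> T" "open T"
    then have "openin riemann_sphere (Some ` T)"
      by (auto simp: openin_Alexandroff_compactification)
    with L T show "\<exists>y\<in>S. y \<in> T \<and> y \<noteq> z"
      unfolding in_derived_set_of by (auto dest!: spec[of _ "Some ` T"])
  qed
next
  assume L: "z islimpt S"
  show "Some z \<in> riemann_sphere derived_set_of (Some ` S)"
    unfolding in_derived_set_of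
  proof (intro conjI allI impI)
    fix T assume T: "Some z \<in> T \<and> openin riemann_sphere T"
    \<comment> \<open>A neighbourhood of a finite point may contain infinity; it is then the
      complement of a compact set, and its finite part is still open in the plane.\<close>
    then obtain V where "open V" "z \<in> V" "Some ` V \<subseteq> T"
      unfolding openin_Alexandroff_compactification by (auto simp: closedin_closed_eq open_Compl Compl_eq_Diff_UNIV[symmetric])
    with L show "\<exists>y. y \<noteq> Some z \<and> y \<in> Some ` S \<and> y \<in> T"
      unfolding islimpt_def by (auto dest!: spec[of _ V])
  qed simp
qed

lemma orbit_eq:
  assumes "subgroup \<Gamma> PSL2R" "Im z > 0"
  shows "(\<lambda>g. PSL_act g (Some z)) ` \<Gamma> = Some ` (\<lambda>A. moebius_mat A z) ` SL_lift \<Gamma>"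
proof -
  have "moebius_ext A (Some z) = Some (moebius_mat A z)" if "A \<in> SL_lift \<Gamma>" for A
    using that assms(2) by (simp add: moebius_ext_def auto_factor_nonzero SL_liftD)
  then show ?thesis
    by (subst proj_PSL_SL_lift[OF assms(1)]) (simp add: image_image)
qed

lemma Some_mem_limit_set:
  assumes "subgroup \<Gamma> PSL2R"
  shows "Some w \<in> limit_set \<Gamma> \<longleftrightarrow>
    (\<exists>z\<in>upper_half_plane. w islimpt (\<lambda>A. moebius_mat A z) ` SL_lift \<Gamma>)"
  using assms
  by (simp add: limit_set_def orbit_eq derived_set_of_riemann_sphere cong: SUP_cong_simp)

section \<open>The group conjugated by the cusp matrix\<close>

definition conj_lift :: "(real^2^2) set set \<Rightarrow> real^2^2 \<Rightarrow> (real^2^2) set" where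
  "conj_lift \<Gamma> S = {B. det B = 1 \<and> S ** B ** adj2 S \<in> SL_lift \<Gamma>}"

lemma conj_liftE:
  assumes "det S = 1" "B \<in> conj_lift \<Gamma> S"
  obtains A where "A \<in> SL_lift \<Gamma>" "A ** S = S ** B"
proof
  show "S ** B ** adj2 S \<in> SL_lift \<Gamma>"
    using assms by (simp add: conj_lift_def)
  show "S ** B ** adj2 S ** S = S ** B"
    using assms by (simp add: matrix_mul_assoc[symmetric] adj2_mult)
qed

lemma conj_liftI:
  assumes "det S = 1" "A \<in> SL_lift \<Gamma>"
  shows "adj2 S ** A ** S \<in> conj_lift \<Gamma> S"
proof -
  have "S ** (adj2 S ** A ** S) ** adj2 S = (S ** adj2 S) ** A ** (S ** adj2 S)"
    by (simp only: matrix_mul_assoc)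
  then show ?thesis
    using assms by (simp add: conj_lift_def mult_adj2 det_mul det_adj2 SL_liftD)
qed

lemma mult_mem_conj_lift:
  assumes "subgroup \<Gamma> PSL2R" "det S = 1" "A \<in> conj_lift \<Gamma> S" "B \<in> conj_lift \<Gamma> S"
  shows "A ** B \<in> conj_lift \<Gamma> S"
proof -
  have "S ** (A ** B) ** adj2 S = S ** A ** (adj2 S ** S) ** B ** adj2 S"
    using assms(2) by (simp add: adj2_mult matrix_mul_assoc)
  also have "\<dots> = (S ** A ** adj2 S) ** (S ** B ** adj2 S)"
    by (simp only: matrix_mul_assoc)
  finally show ?thesis
    using assms mult_mem_SL_lift[OF assms(1)] by (simp add: conj_lift_def det_mul)
qed

lemma adj2_mult_distrib: "adj2 (A ** B) = adj2 B ** adj2 A"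
  by (simp add: vec_eq_iff forall_2 matrix_mult_2_nth adj2_def)

lemma adj2_adj2 [simp]: "adj2 (adj2 A) = A"
  by (simp add: vec_eq_iff forall_2 adj2_def)

lemma adj2_mem_conj_lift:
  assumes "subgroup \<Gamma> PSL2R" "A \<in> conj_lift \<Gamma> S"
  shows "adj2 A \<in> conj_lift \<Gamma> S"
  using assms(2) adj2_mem_SL_lift[OF assms(1), of "S ** A ** adj2 S"]
  by (simp add: conj_lift_def det_adj2 adj2_mult_distrib matrix_mul_assoc)


section \<open>Absolute values of the slash operator\<close>

lemma norm_slash:
  "norm (slash k f A z) = norm (auto_factor A z) powr (- k) * norm (f (moebius_mat A z))"
  by (simp add: slash_def norm_mult norm_powr_real_powr')

text \<open>Principal powers respect products only up to a factor of absolute value one. Since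
  \<open>k\<close> is real, taking norms removes that factor, and the cocycle relation of
  \<open>auto_factor\<close> carries over exactly.\<close>

lemma norm_slash_mult:
  assumes "auto_factor B z \<noteq> 0"
  shows "norm (slash k f (A ** B) z) =
    norm (auto_factor B z) powr (- k) * norm (slash k f A (moebius_mat B z))"
  using assms
  by (simp add: norm_slash auto_factor_mult moebius_mat_mult norm_mult powr_mult)

text \<open>Membership in \<open>M_u\<close> gives the transformation law only off a sparse set. It
  thus holds on a punctured neighbourhood of \<open>z\<close>, and both norms are continuous at
  \<open>z\<close>, so the equality extends to \<open>z\<close> itself.\<close>

lemma norm_slash_M_u:
  assumes "multiplier_system \<Gamma> k \<nu>" "f \<in> M_u \<Gamma> k \<nu>" "continuous_on upper_half_plane f"
    and "A \<in> SL_lift \<Gamma>" "Im z > 0"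
  shows "norm (slash k f A z) = norm (f z)"
proof -
  have H: "open upper_half_plane"
    by (simp add: open_halfspace_Im_gt)
  have cont: "continuous_on upper_half_plane (\<lambda>w. norm (slash k f A w))"
    unfolding norm_slash
    by (intro continuous_intros continuous_on_compose2[OF assms(3) continuous_on_moebius_mat])
       (use assms(4) in \<open>auto simp: SL_liftD auto_factor_nonzero Im_moebius_mat_pos\<close>)
  have 1: "((\<lambda>w. norm (slash k f A w)) \<longlongrightarrow> norm (slash k f A z)) (at z)"
    using cont H assms(5) by (auto simp: continuous_on_eq_continuous_at isCont_def)
  have "eventually (\<lambda>w. slash k f A w = \<nu> A * f w) (at z)"
    using assms(2,4,5) by (auto simp: M_u_def eventually_cosparse_open_eq[OF H])
  then have "eventually (\<lambda>w. norm (f w) = norm (slash k f A w)) (at z)"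
    using assms(1,4) by (auto elim!: eventually_mono simp: multiplier_system_def norm_mult)
  moreover have "((\<lambda>w. norm (f w)) \<longlongrightarrow> norm (f z)) (at z)"
    using assms(3,5) H by (auto intro!: tendsto_norm simp: continuous_on_eq_continuous_at isCont_def)
  ultimately have "((\<lambda>w. norm (slash k f A w)) \<longlongrightarrow> norm (f z)) (at z)"
    by (rule Lim_transform_eventually[rotated])
  with 1 show ?thesis
    by (rule tendsto_unique[OF at_neq_bot])
qed

text \<open>With \<open>A ** S = S ** B\<close>, the norm of the slash by this product is computed
  in two ways: through \<open>B\<close>, and through the invariance under \<open>A\<close>.\<close>

lemma norm_slash_conj_lift:
  assumes "multiplier_system \<Gamma> k \<nu>" "f \<in> M_u \<Gamma> k \<nu>" "continuous_on upper_half_plane f"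
    and "det S = 1" "B \<in> conj_lift \<Gamma> S" "Im z > 0"
  shows "norm (slash k f S (moebius_mat B z)) =
    norm (auto_factor B z) powr k * norm (slash k f S z)"
proof -
  obtain A where A: "A \<in> SL_lift \<Gamma>" "A ** S = S ** B"
    using conj_liftE[OF assms(4,5)] .
  have B: "auto_factor B z \<noteq> 0"
    using assms(5,6) by (auto simp: conj_lift_def auto_factor_nonzero)
  have S: "auto_factor S z \<noteq> 0" "Im (moebius_mat S z) > 0"
    using assms(4,6) by (auto simp: auto_factor_nonzero Im_moebius_mat_pos)
  have "norm (auto_factor B z) powr (- k) * norm (slash k f S (moebius_mat B z)) =
      norm (slash k f (A ** S) z)"
    using B A by (simp add: norm_slash_mult)
  also have "\<dots> = norm (slash k f S z)"
    using S norm_slash_M_u[OF assms(1-3) A(1)] by (simp add: norm_slash_mult norm_slash[of _ _ S])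
  finally show ?thesis
    using B by (simp add: powr_minus field_simps)
qed

section \<open>Groups of the first kind do not fix the cusp\<close>

lemma limit_point_if_small_translations:
  assumes "det S = 1" "Im z > 0" "b \<longlonglongrightarrow> 0"
    and "\<And>j. b j \<noteq> (0::real)"
    and "\<And>j. \<exists>B\<in>conj_lift \<Gamma> S. moebius_mat B z = z + of_real (b j)"
  shows "moebius_mat S z islimpt (\<lambda>A. moebius_mat A (moebius_mat S z)) ` SL_lift \<Gamma>"
  unfolding islimpt_sequential
proof (intro exI conjI allI)
  have z: "auto_factor S z \<noteq> 0"
    using assms by (simp add: auto_factor_nonzero)
  fix j
  obtain B where B: "B \<in> conj_lift \<Gamma> S" "moebius_mat B z = z + of_real (b j)"
    using assms(5) by blast
  then obtain A where A: "A \<in> SL_lift \<Gamma>" "A ** S = S ** B"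
    using conj_liftE[OF assms(1)] by blast
  have "auto_factor B z \<noteq> 0"
    using B assms(2) by (simp add: conj_lift_def auto_factor_nonzero)
  \<comment> \<open>From \<open>A ** S = S ** B\<close>, the small translates of \<open>z\<close>
    are carried by \<open>S\<close> into the orbit of \<open>S z\<close>; they differ from
    \<open>S z\<close> by injectivity of \<open>S\<close> and converge to it by continuity.\<close>
  then have "moebius_mat S (z + of_real (b j)) = moebius_mat A (moebius_mat S z)"
    using A B z by (metis moebius_mat_mult)
  moreover have "moebius_mat S (z + of_real (b j)) \<noteq> moebius_mat S z"
  proof
    assume "moebius_mat S (z + of_real (b j)) = moebius_mat S z"
    then have "z + of_real (b j) = z"
      using moebius_mat_adj2(2)[OF assms(1), of z] moebius_mat_adj2(2)[OF assms(1), of "z + of_real (b j)"]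
        assms(2) by simp
    then show False using assms(4) by simp
  qed
  ultimately show "moebius_mat S (z + of_real (b j)) \<in>
      (\<lambda>A. moebius_mat A (moebius_mat S z)) ` SL_lift \<Gamma> - {moebius_mat S z}"
    using A by auto
next
  have "(\<lambda>j. z + of_real (b j)) \<longlonglongrightarrow> z + of_real 0"
    by (intro tendsto_intros assms(3))
  then show "(\<lambda>j. moebius_mat S (z + of_real (b j))) \<longlonglongrightarrow> moebius_mat S z"
    using assms(1,2) by (auto intro!: isCont_tendsto_compose[OF isCont_moebius_mat] simp: auto_factor_nonzero)
qed

text \<open>A nonzero lower left entry means that \<open>B\<close> moves infinity. It makes the
  automorphy factor of \<open>B\<close> unbounded along the real translates of a point, which drives
  the final argument.\<close>

lemma exists_conj_lift_lower_left_nonzero: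
  assumes "subgroup \<Gamma> PSL2R" "first_kind \<Gamma>" "det S = 1" "n \<noteq> 0"
    and "T \<in> conj_lift \<Gamma> S" "\<And>z. Im z > 0 \<Longrightarrow> moebius_mat T z = z + of_real n"
  shows "\<exists>B\<in>conj_lift \<Gamma> S. B $ 2 $ 1 \<noteq> 0"
proof (rule ccontr)
  assume "\<not> ?thesis"
  then have c0: "B $ 2 $ 1 = 0" if "B \<in> conj_lift \<Gamma> S" for B
    using that by auto
  have ad: "B $ 1 $ 1 * B $ 2 $ 2 = 1" if "B \<in> conj_lift \<Gamma> S" for B
    using c0[OF that] that by (simp add: conj_lift_def det_2)
  have aff: "moebius_mat B z = of_real ((B $ 1 $ 1)\<^sup>2) * z + of_real (B $ 1 $ 1 * B $ 1 $ 2)"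
    if "B \<in> conj_lift \<Gamma> S" for B z
  proof -
    have *: "inverse (B $ 2 $ 2) = B $ 1 $ 1"
      using ad[OF that] by (metis inverse_unique mult.commute)
    have "moebius_mat B z = (of_real (B $ 1 $ 1) * z + of_real (B $ 1 $ 2)) * of_real (inverse (B $ 2 $ 2))"
      using c0[OF that] by (simp add: moebius_mat_eq auto_factor_def divide_inverse)
    then show ?thesis
      by (simp only: *) (simp add: power2_eq_square algebra_simps)
  qed
  have L: "limit_set \<Gamma> = extended_real_line"
    using assms(2) by (simp add: first_kind_def)
  show False
  proof (cases "\<exists>B\<in>conj_lift \<Gamma> S. (B $ 1 $ 1)\<^sup>2 \<noteq> 1")
    case True
    then obtain B where B: "B \<in> conj_lift \<Gamma> S" "(B $ 1 $ 1)\<^sup>2 \<noteq> 1"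
      by blast
    \<comment> \<open>The affine map has scaling factor \<open>a^2\<close>, and its inverse has
      \<open>d^2 = 1/a^2\<close>; one of the two is a contraction.\<close>
    have "\<exists>B\<in>conj_lift \<Gamma> S. (B $ 1 $ 1)\<^sup>2 < 1"
    proof (cases "(B $ 1 $ 1)\<^sup>2 < 1")
      case False
      with B have 1: "(B $ 1 $ 1)\<^sup>2 > 1" by simp
      have 2: "(B $ 1 $ 1)\<^sup>2 * (B $ 2 $ 2)\<^sup>2 = 1"
        using ad[OF B(1)] by (simp flip: power_mult_distrib)
      have "(B $ 2 $ 2)\<^sup>2 < 1"
      proof (rule ccontr)
        assume "\<not> ?thesis"
        then have "1 * (B $ 2 $ 2)\<^sup>2 < (B $ 1 $ 1)\<^sup>2 * (B $ 2 $ 2)\<^sup>2"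
          using 1 by (intro mult_strict_right_mono) auto
        with 2 \<open>\<not> (B $ 2 $ 2)\<^sup>2 < 1\<close> show False by simp
      qed
      then show ?thesis
        using adj2_mem_conj_lift[OF assms(1) B(1)] by (intro bexI[of _ "adj2 B"]) (auto simp: adj2_def)
    qed (use B in blast)
    then obtain B where B: "B \<in> conj_lift \<Gamma> S" "(B $ 1 $ 1)\<^sup>2 < 1" by blast
    define q where "q = (B $ 1 $ 1)\<^sup>2"
    have q: "0 < q" "q < 1"
      using B ad[OF B(1)] by (auto simp: q_def)
    have det: "det B = 1"
      using B by (simp add: conj_lift_def)
    \<comment> \<open>Conjugating a translation by the affine map \<open>B\<close> multiplies its
      length by the scaling factor \<open>q\<close>. Repeating this on \<open>T\<close> gives
      lengths \<open>q ^ j * n\<close>, which tend to 0.\<close>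
    have tr: "\<exists>A\<in>conj_lift \<Gamma> S. \<forall>z. Im z > 0 \<longrightarrow> moebius_mat A z = z + of_real (q ^ j * n)" for j
    proof (induction j)
      case 0
      then show ?case using assms(5,6) by auto
    next
      case (Suc j)
      then obtain A where A: "A \<in> conj_lift \<Gamma> S"
        "\<And>z. Im z > 0 \<Longrightarrow> moebius_mat A z = z + of_real (q ^ j * n)" by blast
      have "moebius_mat (B ** A ** adj2 B) z = z + of_real (q ^ Suc j * n)" if z: "Im z > 0" for z
      proof -
        define w where "w = moebius_mat (adj2 B) z"
        have w: "Im w > 0" "moebius_mat B w = z"
          using det z by (auto simp: w_def Im_moebius_mat_pos det_adj2 moebius_mat_adj2)
        have detA: "det A = 1" using A by (simp add: conj_lift_def)
        have "moebius_mat (B ** A ** adj2 B) z = moebius_mat (B ** A) w"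
          unfolding w_def using det z by (intro moebius_mat_mult auto_factor_nonzero) (auto simp: det_adj2)
        also have "\<dots> = moebius_mat B (moebius_mat A w)"
          using detA w by (intro moebius_mat_mult auto_factor_nonzero)
        also have "\<dots> = moebius_mat B w + of_real (q ^ Suc j * n)"
          using A w by (simp add: aff[OF B(1)] q_def algebra_simps)
        finally show ?thesis using w by simp
      qed
      moreover have "B ** A ** adj2 B \<in> conj_lift \<Gamma> S"
        using A B assms(1,3) by (intro mult_mem_conj_lift adj2_mem_conj_lift)
      ultimately show ?case by blast
    qed
    have tri: "\<exists>B\<in>conj_lift \<Gamma> S. moebius_mat B \<i> = \<i> + of_real (q ^ j * n)" for j
      using tr[of j] by (auto dest!: spec[of _ \<i>])
    have "(\<lambda>j. q ^ j * n) \<longlonglongrightarrow> 0 * n"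
      using q by (intro tendsto_intros LIMSEQ_realpow_zero) auto
    then have "moebius_mat S \<i> islimpt (\<lambda>A. moebius_mat A (moebius_mat S \<i>)) ` SL_lift \<Gamma>"
      using tri q assms(3,4)
      by (intro limit_point_if_small_translations[where b = "\<lambda>j. q ^ j * n"]) auto
    moreover have Im: "Im (moebius_mat S \<i>) > 0"
      using assms(3) by (simp add: Im_moebius_mat_pos)
    ultimately have "Some (moebius_mat S \<i>) \<in> limit_set \<Gamma>"
      using Some_mem_limit_set[OF assms(1)] by blast
    then show False
      using Im unfolding L by (auto simp: extended_real_line_def)
  next
    case False
    \<comment> \<open>The expression is the automorphy factor of the inverse of \<open>S\<close> at
      \<open>r\<close>. So \<open>r\<close> is a real point other than the cusp, and the inverse of
      \<open>S\<close> is continuous there.\<close>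
    have "\<exists>r::real. - S $ 2 $ 1 * r + S $ 1 $ 1 \<noteq> 0"
    proof (cases "S $ 2 $ 1 = 0")
      case False
      then show ?thesis by (intro exI[of _ "S $ 1 $ 1 / S $ 2 $ 1 + 1"]) (simp add: field_simps)
    qed (use assms(3) in \<open>auto simp: det_2\<close>)
    then obtain r :: real where r: "- S $ 2 $ 1 * r + S $ 1 $ 1 \<noteq> 0" by blast
    define h where "h = moebius_mat (adj2 S)"
    have "auto_factor (adj2 S) (of_real r) = of_real (- S $ 2 $ 1 * r + S $ 1 $ 1)"
      by (simp add: auto_factor_def adj2_def)
    then have cont: "isCont h (of_real r)"
      using r unfolding h_def by (intro isCont_moebius_mat) (simp del: of_real_add of_real_mult of_real_minus)
    have hr: "Im (h (of_real r)) = 0"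
      by (simp add: h_def moebius_mat_eq auto_factor_def Im_complex_div_eq_0)
    have "Some (of_real r) \<in> limit_set \<Gamma>"
      by (auto simp: L extended_real_line_def)
    then obtain z where z: "Im z > 0" "of_real r islimpt (\<lambda>A. moebius_mat A z) ` SL_lift \<Gamma>"
      using Some_mem_limit_set[OF assms(1)] by blast
    then obtain u where u: "\<And>j. u j \<in> (\<lambda>A. moebius_mat A z) ` SL_lift \<Gamma>" "u \<longlonglongrightarrow> of_real r"
      unfolding islimpt_sequential by blast
    have hz: "Im (h z) > 0"
      using z assms(3) by (simp add: h_def Im_moebius_mat_pos det_adj2)
    \<comment> \<open>All scaling factors are now 1, so in the coordinate \<open>h\<close> the orbit
      stays on one horizontal line. It would nevertheless have to converge to the real point
      \<open>h r\<close>.\<close>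
    have "Im (h (u j)) = Im (h z)" for j
    proof -
      obtain A where A: "A \<in> SL_lift \<Gamma>" "u j = moebius_mat A z" using u by blast
      let ?B = "adj2 S ** A ** S"
      have B: "?B \<in> conj_lift \<Gamma> S" by (rule conj_liftI[OF assms(3) A(1)])
      have "moebius_mat ?B (h z) = moebius_mat (adj2 S ** A) (moebius_mat S (h z))"
        using hz assms(3) by (intro moebius_mat_mult auto_factor_nonzero)
      also have "\<dots> = h (u j)"
        using z A assms(3)
        by (simp add: h_def moebius_mat_adj2 moebius_mat_mult auto_factor_nonzero SL_liftD)
      finally have "h (u j) = moebius_mat ?B (h z)" ..
      moreover have "(?B $ 1 $ 1)\<^sup>2 = 1"
        using False B by blast
      ultimately show ?thesis by (simp add: aff[OF B])
    qed
    moreover have "(\<lambda>j. Im (h (u j))) \<longlonglongrightarrow> Im (h (of_real r))"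
      by (intro tendsto_Im isCont_tendsto_compose[OF cont] u)
    ultimately show False using hr hz by (simp add: LIMSEQ_const_iff)
  qed
qed


section \<open>The transformation law on the real line\<close>

lemma norm_boundary_transformation:
  assumes "isCont G (of_real s)" "isCont G (moebius_mat B (of_real s))" "auto_factor B (of_real s) \<noteq> 0"
    and "\<And>z. Im z > 0 \<Longrightarrow> norm (G (moebius_mat B z)) = norm (auto_factor B z) powr k * norm (G z)"
  shows "norm (G (moebius_mat B (of_real s))) =
    norm (auto_factor B (of_real s)) powr k * norm (G (of_real s))"
proof -
  \<comment> \<open>The real point is approached vertically from inside the half-plane.\<close>
  define w where "w = (\<lambda>j. complex_of_real s + \<i> * of_real (inverse (real (Suc j))))"
  have "w \<longlonglongrightarrow> of_real s + \<i> * of_real 0"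
    unfolding w_def by (intro tendsto_intros LIMSEQ_inverse_real_of_nat)
  then have w: "w \<longlonglongrightarrow> of_real s" by simp
  have "(\<lambda>j. norm (G (moebius_mat B (w j)))) \<longlonglongrightarrow> norm (G (moebius_mat B (of_real s)))"
    by (intro tendsto_norm isCont_tendsto_compose[OF assms(2)]
          isCont_tendsto_compose[OF isCont_moebius_mat[OF assms(3)]] w)
  moreover have "Im (w j) > 0" for j
    by (simp add: w_def)
  ultimately have "(\<lambda>j. norm (auto_factor B (w j)) powr k * norm (G (w j))) \<longlonglongrightarrow>
      norm (G (moebius_mat B (of_real s)))"
    by (simp add: assms(4))
  moreover have "(\<lambda>j. auto_factor B (w j)) \<longlonglongrightarrow> auto_factor B (of_real s)"
    unfolding auto_factor_def by (intro tendsto_intros w)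
  then have "(\<lambda>j. norm (auto_factor B (w j)) powr k * norm (G (w j))) \<longlonglongrightarrow>
      norm (auto_factor B (of_real s)) powr k * norm (G (of_real s))"
    using assms(3) by (intro tendsto_intros isCont_tendsto_compose[OF assms(1)] w) auto
  ultimately show ?thesis
    by (rule LIMSEQ_unique)
qed

text \<open>The hypotheses concern norms only: in the application, \<open>G\<close> is periodic
  merely up to the constant \<open>exp (2 pi i kappa)\<close>, and its transformation law is
  available for absolute values.\<close>

lemma entire_eq_0_if_automorphic_on_reals:
  fixes G :: "complex \<Rightarrow> complex" and B :: "real^2^2" and n k C :: real
  assumes hol: "G holomorphic_on UNIV"
    and bound: "\<And>s::real. norm (G (of_real s)) \<le> C"
    and per: "\<And>s::real. norm (G (of_real (s + n))) = norm (G (of_real s))"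
    and "n \<noteq> 0" "k \<noteq> 0" "det B = 1" "B $ 2 $ 1 \<noteq> 0"
    and trans: "\<And>s::real. auto_factor B (of_real s) \<noteq> 0 \<Longrightarrow>
      norm (G (moebius_mat B (of_real s))) =
      norm (auto_factor B (of_real s)) powr k * norm (G (of_real s))"
  shows "G z = 0"
proof -
  define a b c d where abcd: "a = B $ 1 $ 1" "b = B $ 1 $ 2" "c = B $ 2 $ 1" "d = B $ 2 $ 2"
  have det: "a * d - b * c = 1" and c: "c \<noteq> 0"
    using assms(6,7) by (simp_all add: abcd det_2)
  have zeroI: "G z = 0" if "\<xi> islimpt {z. G z = 0}" for \<xi>
    by (rule analytic_continuation[OF hol _ _ _ _ that]) auto
  \<comment> \<open>\<open>y s j\<close> are the translates of \<open>s\<close>,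
    \<open>u s j\<close> is the automorphy factor of \<open>B\<close> there, and
    \<open>v s j\<close> is the image under \<open>B\<close>, written so that its limit
    \<open>a / c\<close>, the image of infinity, is visible.\<close>
  define y where "y = (\<lambda>s j. s + real j * n)"
  define u where "u = (\<lambda>s j. c * y s j + d)"
  define v where "v = (\<lambda>s j. a / c - 1 / (c * u s j))"
  have per': "norm (G (of_real (y s j))) = norm (G (of_real s))" for s j
  proof (induction j)
    case (Suc j)
    have "y s (Suc j) = y s j + n" by (simp add: y_def algebra_simps)
    then show ?case using Suc per[of "y s j"] by simp
  qed (simp add: y_def)
  have v: "norm (G (of_real (v s j))) = \<bar>u s j\<bar> powr k * norm (G (of_real s))" if "u s j \<noteq> 0" for s j
  proof -
    have j: "auto_factor B (of_real (y s j)) = of_real (u s j)"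
      by (simp add: auto_factor_def u_def abcd)
    have "c * (v s j * u s j) = a * u s j - 1"
      using c that by (simp add: v_def field_simps)
    also have "\<dots> = c * (a * y s j + b)"
      using det by (simp add: u_def algebra_simps)
    finally have "a * y s j + b = v s j * u s j"
      using c by simp
    then have "moebius_mat B (of_real (y s j)) = of_real (v s j)"
      using that by (simp add: moebius_mat_eq j abcd(1,2) flip: of_real_mult of_real_add of_real_divide)
    then show ?thesis
      using trans[of "y s j"] that by (simp add: j per')
  qed
  have "filterlim (\<lambda>j. (c * s + d) + (c * n) * real j) at_infinity sequentially" for s
    using c assms(4)
    by (intro tendsto_add_filterlim_at_infinity[OF tendsto_const]
          tendsto_mult_filterlim_at_infinity[OF tendsto_const]
          filterlim_at_top_imp_at_infinity filterlim_real_sequentially) auto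
  moreover have "u s = (\<lambda>j. (c * s + d) + (c * n) * real j)" for s
    by (simp add: fun_eq_iff u_def y_def algebra_simps)
  ultimately have u: "filterlim (u s) at_infinity sequentially" for s
    by simp
  \<comment> \<open>\<open>u s\<close> is affine in \<open>j\<close> with slope
    \<open>c * n\<close>, so only finitely many \<open>j\<close> have to be discarded.\<close>
  have u_ne: "eventually (\<lambda>j. u s j \<noteq> 0) sequentially" for s
    by (rule filterlim_at_infinity_imp_eventually_ne[OF u])
  have u_top: "filterlim (\<lambda>j. \<bar>u s j\<bar>) at_top sequentially" for s
    using filterlim_at_infinity_imp_norm_at_top[OF u] by simp
  have "(\<lambda>j. a / c - inverse c * inverse (u s j)) \<longlonglongrightarrow> a / c - inverse c * 0" for s
    by (intro tendsto_intros filterlim_compose[OF tendsto_inverse_0 u])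
  then have v_lim: "v s \<longlonglongrightarrow> a / c" for s
    by (simp add: v_def[abs_def] divide_inverse)
  show ?thesis
  proof (cases "k > 0")
    case True
    have "G (of_real s) = 0" for s
    proof -
      have "(\<lambda>j. \<bar>u s j\<bar> powr (- k) * C) \<longlonglongrightarrow> 0 * C"
        using True by (intro tendsto_intros tendsto_neg_powr u_top) auto
      moreover have "eventually (\<lambda>j. norm (G (of_real s)) \<le> \<bar>u s j\<bar> powr (- k) * C) sequentially"
        using u_ne[of s]
      proof eventually_elim
        case (elim j)
        then have "norm (G (of_real s)) = \<bar>u s j\<bar> powr (- k) * norm (G (of_real (v s j)))"
          by (simp add: v powr_minus field_simps)
        also have "\<dots> \<le> \<bar>u s j\<bar> powr (- k) * C"
          by (intro mult_left_mono bound) auto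
        finally show ?case .
      qed
      ultimately have "norm (G (of_real s)) \<le> 0 * C"
        by (intro tendsto_lowerbound[of _ _ sequentially]) auto
      then show ?thesis by simp
    qed
    then have "range of_real \<subseteq> {z. G z = 0}" by auto
    moreover have "complex_of_real 0 islimpt range of_real"
      unfolding islimpt_sequential
      by (intro exI[of _ "\<lambda>j. of_real (inverse (real (Suc j)))"] conjI tendsto_of_real
            LIMSEQ_inverse_real_of_nat) (auto simp del: of_real_inverse of_real_0)
    ultimately show ?thesis
      using islimpt_subset zeroI by blast
  next
    \<comment> \<open>Here \<open>k < 0\<close>. The base point 0 is arbitrary: the images
      \<open>v 0 j\<close> approach \<open>a / c\<close> while the norms of \<open>G\<close> at them
      tend to 0.\<close>
    case False
    have "G (of_real (a / c)) = 0"
    proof -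
      have "(\<lambda>j. \<bar>u 0 j\<bar> powr k * norm (G (of_real 0))) \<longlonglongrightarrow> 0 * norm (G (of_real 0))"
        using False assms(5) by (intro tendsto_intros tendsto_neg_powr u_top) auto
      moreover have "eventually (\<lambda>j. \<bar>u 0 j\<bar> powr k * norm (G (of_real 0)) = norm (G (of_real (v 0 j)))) sequentially"
        using u_ne[of 0] by eventually_elim (simp add: v)
      ultimately have "(\<lambda>j. norm (G (of_real (v 0 j)))) \<longlonglongrightarrow> 0 * norm (G (of_real 0))"
        by (rule Lim_transform_eventually)
      moreover have "isCont G (of_real (a / c))"
        using holomorphic_on_imp_continuous_on[OF hol] by (simp add: continuous_on_eq_continuous_at)
      then have "(\<lambda>j. norm (G (of_real (v 0 j)))) \<longlonglongrightarrow> norm (G (of_real (a / c)))"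
        by (intro tendsto_norm isCont_tendsto_compose[of _ G] tendsto_of_real v_lim)
      ultimately have "0 * norm (G (of_real 0)) = norm (G (of_real (a / c)))"
        by (rule LIMSEQ_unique)
      then show ?thesis by simp
    qed
    \<comment> \<open>The construction is restarted from the zero \<open>a / c\<close>, whose
      translates have images that are again zeros.\<close>
    then have "G (of_real (v (a / c) j)) = 0" if "u (a / c) j \<noteq> 0" for j
      using v[OF that] by simp
    then have v0: "eventually (\<lambda>j. G (of_real (v (a / c) j)) = 0) sequentially"
      by (intro eventually_mono[OF u_ne[of "a / c"]])
    have "complex_of_real (a / c) islimpt {z. G z = 0}"
    proof -
      \<comment> \<open>The shift by \<open>J\<close> skips the \<open>j\<close> with
        \<open>u = 0\<close>, where division by zero would make \<open>v\<close> equal to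
        \<open>a / c\<close>. Elsewhere \<open>v\<close> differs from \<open>a / c\<close> by
        \<open>1 / (c * u)\<close>, so the zeros do accumulate.\<close>
      obtain J where J: "\<And>j. j \<ge> J \<Longrightarrow> G (of_real (v (a / c) j)) = 0 \<and> u (a / c) j \<noteq> 0"
        using eventually_conj[OF v0 u_ne[of "a / c"]] by (auto simp: eventually_sequentially)
      show ?thesis
        unfolding islimpt_sequential
      proof (intro exI conjI allI)
        fix j
        have "v (a / c) (j + J) \<noteq> a / c"
          using J[of "j + J"] c by (simp add: v_def)
        then show "complex_of_real (v (a / c) (j + J)) \<in> {z. G z = 0} - {complex_of_real (a / c)}"
          using J[of "j + J"] by (simp only: of_real_eq_iff Diff_iff mem_Collect_eq singleton_iff) auto
      next
        show "(\<lambda>j. complex_of_real (v (a / c) (j + J))) \<longlonglongrightarrow> of_real (a / c)"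
          by (intro tendsto_of_real LIMSEQ_ignore_initial_segment v_lim)
      qed
    qed
    then show ?thesis by (rule zeroI)
  qed
qed

section \<open>Finite Fourier expansions at a cusp\<close>

theorem theorem11p4:
  fixes \<Gamma> :: "(real^2^2) set set" and k :: real and \<nu> :: "real^2^2 \<Rightarrow> complex"
    and f :: "complex \<Rightarrow> complex" and x :: "complex option" and \<gamma> \<gamma>' :: "(real^2^2) set"
    and n \<kappa> :: real and N :: int and a :: "int \<Rightarrow> complex"
  assumes "fuchsian_group \<Gamma>" and "first_kind \<Gamma>"
    and "k \<noteq> 0"
    and "multiplier_system \<Gamma> k \<nu>"
    and "f \<in> M_u \<Gamma> k \<nu>" and "f holomorphic_on upper_half_plane"
    and "x \<in> extended_real_line" and "\<gamma> \<in> \<Gamma>" and "parabolic \<gamma>" and "PSL_act \<gamma> x = x"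
    and "\<gamma>' \<in> {\<gamma>, inv\<^bsub>PSL2R\<^esub> \<gamma>}" and "n > 0" and "conj_to_translation \<gamma>' x n"
    and "0 \<le> \<kappa>" and "\<kappa> < 1"
    and "\<forall>z\<in>upper_half_plane. slash k f (cusp_matrix x) (z + of_real n) =
           exp (2 * of_real pi * \<i> * of_real \<kappa>) * slash k f (cusp_matrix x) z"
    and "has_cusp_expansion f k x n \<kappa> N a"
    and "\<exists>M. \<forall>m\<ge>M. a m = 0"
  shows "\<forall>z\<in>upper_half_plane. f z = 0"
proof -
  define S where "S = cusp_matrix x"
  have S: "det S = 1"
    by (simp add: S_def det_cusp_matrix)
  have \<Gamma>: "subgroup \<Gamma> PSL2R"
    using assms(1) by (simp add: fuchsian_group_def)
  have "\<gamma>' \<in> \<Gamma>"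
    using assms(8,11) subgroup.m_inv_closed[OF \<Gamma>] by auto
  then obtain A where A: "A \<in> SL_lift \<Gamma>" "\<gamma>' = proj_PSL A"
    using proj_PSL_SL_lift[OF \<Gamma>] by blast
  \<comment> \<open>\<open>T\<close> is a matrix representing the translation by \<open>n\<close> in
    the conjugated group.\<close>
  define T where "T = adj2 S ** A ** S"
  have T: "T \<in> conj_lift \<Gamma> S"
    unfolding T_def by (intro conj_liftI S A)
  then have "det T = 1"
    by (simp add: conj_lift_def)
  have "inv\<^bsub>PSL2R\<^esub> (proj_PSL S) \<otimes>\<^bsub>PSL2R\<^esub> \<gamma>' \<otimes>\<^bsub>PSL2R\<^esub> proj_PSL S = proj_PSL T"
    using S A by (simp add: T_def inv_proj_PSL proj_PSL_mult det_adj2 det_mul SL_liftD)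
  then have T_trans: "moebius_mat T z = z + of_real n" if "Im z > 0" for z
    using assms(13) that \<open>det T = 1\<close>
    by (simp add: conj_to_translation_def Let_def S_def[symmetric] moebius_ext_def auto_factor_nonzero)
  obtain B where B: "B \<in> conj_lift \<Gamma> S" "B $ 2 $ 1 \<noteq> 0"
    using exists_conj_lift_lower_left_nonzero[OF \<Gamma> assms(2) S _ T T_trans] assms(12) by auto
  then have "det B = 1"
    by (simp add: conj_lift_def)
  obtain M where M: "\<And>m. m \<ge> M \<Longrightarrow> a m = 0"
    using assms(18) by blast
  \<comment> \<open>The real parameter \<open>t\<close> covers both \<open>kappa\<close> and the
    integer frequencies.\<close>
  define e where "e = (\<lambda>t z. exp (2 * of_real pi * \<i> * of_real t * z / of_real n))"
  define G where "G = (\<lambda>z. e \<kappa> z * (\<Sum>m\<in>{N..<M}. a m * e (of_int m) z))"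
  have slash_eq: "slash k f S z = G z" if "Im z > 0" for z
  proof -
    \<comment> \<open>The coefficients vanish from \<open>M\<close> on, so the series is a finite
      sum, which makes sense on the whole plane.\<close>
    have "(\<Sum>\<^sub>\<infinity>m\<in>{N..}. a m * e (of_int m) z) = (\<Sum>\<^sub>\<infinity>m\<in>{N..<M}. a m * e (of_int m) z)"
      using M by (intro infsum_cong_neutral) auto
    then show ?thesis
      using assms(17) that by (simp add: has_cusp_expansion_def S_def G_def e_def)
  qed
  have norm_e: "norm (e t (of_real s)) = 1" for t s
    by (simp add: e_def)
  have e_per: "e t (z + of_real n) = exp (2 * of_real pi * \<i> * of_real t) * e t z" for t z
    using assms(12) by (simp add: e_def add_divide_distrib distrib_left exp_add)
  have e_per_int: "e (of_int m) (z + of_real n) = e (of_int m) z" for m z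
    using exp_integer_2pi[of "of_int m"] by (simp add: e_per mult_ac)
  have cont_f: "continuous_on upper_half_plane f"
    using assms(6) by (rule holomorphic_on_imp_continuous_on)
  have hol: "G holomorphic_on UNIV"
    unfolding G_def e_def using assms(12) by (intro holomorphic_intros) auto
  then have cont: "isCont G w" for w
    using holomorphic_on_imp_continuous_on[of G UNIV] by (simp add: continuous_on_eq_continuous_at)
  have "G w = 0" for w
  proof (rule entire_eq_0_if_automorphic_on_reals[OF hol])
    show "norm (G (of_real s)) \<le> (\<Sum>m\<in>{N..<M}. norm (a m))" for s
      by (auto simp: G_def norm_mult norm_e intro!: sum_norm_le)
    \<comment> \<open>The finite sum is \<open>n\<close>-periodic, and the prefactor
      \<open>e \<kappa>\<close> only picks up a constant of absolute value one.\<close>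
    show "norm (G (of_real (s + n))) = norm (G (of_real s))" for s
      by (simp add: G_def e_per_int norm_mult) (simp add: e_per norm_mult)
    show "norm (G (moebius_mat B (of_real s))) =
        norm (auto_factor B (of_real s)) powr k * norm (G (of_real s))"
      if "auto_factor B (of_real s) \<noteq> 0" for s
      using norm_slash_conj_lift[OF assms(4,5) cont_f S B(1)] that \<open>det B = 1\<close>
      by (intro norm_boundary_transformation cont) (auto simp: slash_eq Im_moebius_mat_pos)
  qed (use assms(3,12) B \<open>det B = 1\<close> in auto)
  show ?thesis
  proof
    fix z assume "z \<in> upper_half_plane"
    then have z: "Im z > 0" by simp
    \<comment> \<open>At the preimage of \<open>z\<close> under \<open>S\<close>, the value of
      \<open>G\<close> is a nonzero factor times \<open>f z\<close>.\<close>
    let ?w = "moebius_mat (adj2 S) z"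
    have "Im ?w > 0"
      using S z by (simp add: Im_moebius_mat_pos det_adj2)
    then show "f z = 0"
      using slash_eq[of ?w] \<open>G ?w = 0\<close> S z
      by (simp add: slash_def moebius_mat_adj2 auto_factor_nonzero)
  qed
qed

end
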